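(* There exist constants $c>0$ and $\epsilon_0>0$ such that for every $\epsilon\in(0,\epsilon_0)$, every online algorithm for the lax static case of \textsc{SubsetSum} with competitive ratio $1-\epsilon$ has amortized migration factor at least $c/\epsilon$ on some online instance.
   Context: \textsc{SubsetSum}: a fixed capacity $C\in\mathbb N$ and items with sizes $s_i\in\mathbb N$; a subset is feasible iff its total size is at most $C$, and its profit is its total size. Lax static case: at time $1$ an arbitrary (possibly non-empty) instance $I_1$ is presented, contributing no migration potential. Afterwards, at each time step exactly one item arrives, and items never depart. The online algorithm outputs at every time $t$ a feasible subset $S_t$ without knowledge of the future. Competitive ratio $1-\epsilon$ means $\mathrm{profit}(S_t)\ge(1-\epsilon)\mathrm{opt}(I_t)$ for all $t$. The migration potential of a step $t\ge2$ is the size of the arriving item. The migration cost of changing $S_{t-1}$ to $S_t$ is the total size of $S_{t-1}\triangle S_t$, excluding the newly arrived item; the solution $S_1$ is free. The amortized migration factor is the maximum over $t$ of (total migration cost up to $t$)/(total migration potential up to $t$). *)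

theory Defs
  imports Complex_Main "HOL-Library.Extended_Nonnegative_Real"
begin

(* A list of sizes represents an instance; items are identified with positions in the list,
   so items of equal size remain distinct. *)

definition total_size :: "nat list \<Rightarrow> nat set \<Rightarrow> nat" where
  "total_size s X = (\<Sum>i\<in>X. s ! i)"

definition feasible :: "nat \<Rightarrow> nat list \<Rightarrow> nat set \<Rightarrow> bool" where
  "feasible C s X \<longleftrightarrow> X \<subseteq> {..<length s} \<and> total_size s X \<le> C"

definition profit :: "nat list \<Rightarrow> nat set \<Rightarrow> nat" where
  "profit s X = total_size s X"

definition opt :: "nat \<Rightarrow> nat list \<Rightarrow> nat" where
  "opt C s = Max (profit s ` {X. feasible C s X})"

(* An online instance of the lax static case consists of a capacity C, the arbitrary sizes init
   presented at time 1, and the list arr of sizes arriving afterwards, where arr ! (t - 2) arrives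
   at time t.  Its time steps are 1, ..., horizon arr. *)

definition horizon :: "nat list \<Rightarrow> nat" where
  "horizon arr = Suc (length arr)"

definition instance_at :: "nat list \<Rightarrow> nat list \<Rightarrow> nat \<Rightarrow> nat list" where
  "instance_at init arr t = init @ take (t - 1) arr"

(* A deterministic algorithm maps what has been revealed so far (capacity, initial sizes,
   arrived sizes) to a set of item positions.  Its own earlier outputs are determined by this
   information, so they need not be passed as an argument. *)
type_synonym algorithm = "nat \<Rightarrow> nat list \<Rightarrow> nat list \<Rightarrow> nat set"

definition solution_at :: "algorithm \<Rightarrow> nat \<Rightarrow> nat list \<Rightarrow> nat list \<Rightarrow> nat \<Rightarrow> nat set" where
  "solution_at A C init arr t = A C init (take (t - 1) arr)"

definition online_algorithm :: "algorithm \<Rightarrow> bool" where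
  "online_algorithm A \<longleftrightarrow>
     (\<forall>C init arr. \<forall>t\<in>{1..horizon arr}.
        feasible C (instance_at init arr t) (solution_at A C init arr t))"

definition has_competitive_ratio :: "algorithm \<Rightarrow> real \<Rightarrow> bool" where
  "has_competitive_ratio A \<rho> \<longleftrightarrow>
     (\<forall>C init arr. \<forall>t\<in>{1..horizon arr}.
        real (profit (instance_at init arr t) (solution_at A C init arr t))
          \<ge> \<rho> * real (opt C (instance_at init arr t)))"

definition migration_potential :: "nat list \<Rightarrow> nat \<Rightarrow> nat" where
  "migration_potential arr t = arr ! (t - 2)"

(* The item arriving at time t has position length init + (t - 2). *)
definition migration_cost :: "algorithm \<Rightarrow> nat \<Rightarrow> nat list \<Rightarrow> nat list \<Rightarrow> nat \<Rightarrow> nat" where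
  "migration_cost A C init arr t =
     total_size (instance_at init arr t)
       (sym_diff (solution_at A C init arr (t - 1)) (solution_at A C init arr t)
          - {length init + (t - 2)})"

(* In ennreal, a positive cost divided by zero potential is infinite and 0 / 0 = 0.
   Time 1 contributes 0 / 0 = 0, so the maximum is over a nonempty set also if nothing arrives. *)
definition amortized_migration_factor ::
    "algorithm \<Rightarrow> nat \<Rightarrow> nat list \<Rightarrow> nat list \<Rightarrow> ennreal" where
  "amortized_migration_factor A C init arr =
     Max ((\<lambda>t. of_nat (\<Sum>u\<in>{2..t}. migration_cost A C init arr u) /
                of_nat (\<Sum>u\<in>{2..t}. migration_potential arr u)) ` {1..horizon arr})"

end

theory Submission
  imports Defs
begin

text \<open>Choose the capacity \<open>n\<close> with \<open>1 / \<epsilon> - 1 \<le> n < 1 / \<epsilon>\<close>, so that a loss of a single unit of profit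
  already violates the ratio \<open>1 - \<epsilon>\<close>. Of two initial items with sizes \<open>n - 1\<close> and \<open>n - 2\<close> the
  algorithm must pack exactly the larger one. When an item of size \<open>2\<close> arrives, the only solution
  of profit \<open>n\<close> consists of this item and the smaller initial one, so \<open>2 n - 3\<close> is migrated against
  a potential of \<open>2\<close>.\<close>

lemma profit_le_opt:
  assumes "feasible C s X"
  shows "profit s X \<le> opt C s"
proof -
  have "{X. feasible C s X} \<subseteq> Pow {..<length s}"
    by (auto simp: feasible_def)
  then have "finite {X. feasible C s X}"
    by (rule finite_subset) simp
  with assms show ?thesis
    unfolding opt_def by (intro Max_ge) auto
qed

text \<open>Profits are integers: the ratio forces a profit of at least
  \<open>(1 - \<epsilon>) * P\<close>, which exceeds \<open>P - 1\<close> because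
  \<open>\<epsilon> * P < 1\<close>.\<close>

lemma profit_solution_at_optimal:
  assumes "has_competitive_ratio A (1 - \<epsilon>)" and "0 < \<epsilon>" and "\<epsilon> * real P < 1"
    and "t \<in> {1..horizon arr}"
    and "feasible C (instance_at init arr t) X" and "profit (instance_at init arr t) X = P"
  shows "P \<le> profit (instance_at init arr t) (solution_at A C init arr t)"
    (is "_ \<le> ?p")
proof -
  let ?o = "opt C (instance_at init arr t)"
  have "P \<le> ?o"
    using profit_le_opt[OF assms(5)] assms(6) by simp
  have ratio: "(1 - \<epsilon>) * real ?o \<le> real ?p"
    using assms(1,4) by (auto simp: has_competitive_ratio_def)
  show ?thesis
  proof (cases "\<epsilon> \<le> 1")
    case True
    then have "(1 - \<epsilon>) * real P \<le> (1 - \<epsilon>) * real ?o"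
      using \<open>P \<le> ?o\<close> by (intro mult_left_mono) auto
    then have "real P - \<epsilon> * real P \<le> real ?p"
      using ratio by (simp add: algebra_simps)
    then show ?thesis
      using assms(3) by linarith
  next
    \<comment> \<open>For \<open>\<epsilon> > 1\<close> the factor \<open>1 - \<epsilon>\<close> is
      negative and monotonicity fails, but then \<open>\<epsilon> * P < 1\<close> leaves only
      \<open>P = 0\<close>.\<close>
    case False
    have "P = 0"
    proof (rule ccontr)
      assume "P \<noteq> 0"
      then have "1 * 1 \<le> \<epsilon> * real P"
        using False by (intro mult_mono) auto
      then show False
        using assms(3) by simp
    qed
    then show ?thesis by simp
  qed
qed

text \<open>Both items together have size \<open>2 * n - 3\<close>, which exceeds the capacity
  exactly when \<open>3 < n\<close>; the smaller one alone is one unit short.\<close>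

lemma forced_solution_at_1:
  assumes "feasible n [n - 1, n - 2] S" and "n - 1 \<le> profit [n - 1, n - 2] S" and "3 < n"
  shows "S = {0}"
proof -
  have "S \<in> Pow {0, 1}"
    using assms(1) by (auto simp: feasible_def less_Suc_eq)
  then have "S = {} \<or> S = {0} \<or> S = {1} \<or> S = {0, 1}"
    unfolding Pow_insert Pow_empty by auto
  then show ?thesis
    using assms by (elim disjE) (auto simp: feasible_def profit_def total_size_def)
qed

text \<open>Adding the new item to the larger old one gives \<open>n + 1\<close>, just too much; the
  two old items still do not fit together, and every single item is smaller than
  \<open>n\<close>.\<close>

lemma forced_solution_at_2:
  assumes "feasible n [n - 1, n - 2, 2] S" and "n \<le> profit [n - 1, n - 2, 2] S" and "3 < n"
  shows "S = {1, 2}"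
proof -
  have "S \<in> Pow {0, 1, 2}"
    using assms(1) by (auto simp: feasible_def less_Suc_eq numeral_2_eq_2)
  then have "S = {} \<or> S = {0} \<or> S = {1} \<or> S = {2} \<or> S = {0, 1} \<or> S = {0, 2} \<or> S = {1, 2}
    \<or> S = {0, 1, 2}"
    unfolding Pow_insert Pow_empty by auto
  then show ?thesis
    using assms by (elim disjE) (auto simp: feasible_def profit_def total_size_def)
qed

lemma amortized_migration_factor_lower_bound:
  assumes "online_algorithm A" and "has_competitive_ratio A (1 - \<epsilon>)"
    and "0 < \<epsilon>" and "\<epsilon> * real n < 1" and "3 < n"
  shows "ennreal ((2 * real n - 3) / 2) \<le> amortized_migration_factor A n [n - 1, n - 2] [2]"
proof -
  let ?init = "[n - 1, n - 2]"
  have inst1: "instance_at ?init [2] 1 = ?init"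
    and inst2: "instance_at ?init [2] 2 = [n - 1, n - 2, 2]"
    by (simp_all add: instance_at_def)
  have times: "1 \<in> {1..horizon [2]}" "2 \<in> {1..horizon [2]}"
    by (simp_all add: horizon_def)
  have feas1: "feasible n ?init (solution_at A n ?init [2] 1)"
    and feas2: "feasible n [n - 1, n - 2, 2] (solution_at A n ?init [2] 2)"
    using assms(1) times unfolding online_algorithm_def by (metis inst1, metis inst2)
  have "\<epsilon> * real (n - 1) \<le> \<epsilon> * real n"
    using assms(3) by (intro mult_left_mono) auto
  then have "\<epsilon> * real (n - 1) < 1"
    using assms(4) by simp
  then have "n - 1 \<le> profit ?init (solution_at A n ?init [2] 1)"
    using profit_solution_at_optimal[OF assms(2,3) _ times(1), of "n - 1" n ?init "{0}"]
    unfolding inst1 by (simp add: feasible_def profit_def total_size_def)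
  with feas1 have sol1: "solution_at A n ?init [2] 1 = {0}"
    using assms(5) by (rule forced_solution_at_1)
  have "n \<le> profit [n - 1, n - 2, 2] (solution_at A n ?init [2] 2)"
    using profit_solution_at_optimal[OF assms(2-4) times(2), of n ?init "{1, 2}"] assms(5)
    unfolding inst2 by (simp add: feasible_def profit_def total_size_def)
  with feas2 have sol2: "solution_at A n ?init [2] 2 = {1, 2}"
    using assms(5) by (rule forced_solution_at_2)
  \<comment> \<open>Position 2 is the arriving item, whose insertion is free; both initial items
    change status and are paid for.\<close>
  have "sym_diff {0} {1, 2} - {length ?init + (2 - 2)} = {0, 1}"
    by auto
  moreover have "solution_at A n ?init [2] (2 - 1) = {0}"
    using sol1 by simp
  ultimately have "migration_cost A n ?init [2] 2 = total_size [n - 1, n - 2, 2] {0, 1}"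
    unfolding migration_cost_def inst2 sol2 by metis
  then have cost: "migration_cost A n ?init [2] 2 = 2 * n - 3"
    using assms(5) by (simp add: total_size_def)
  have "ennreal ((2 * real n - 3) / 2) = of_nat (2 * n - 3) / of_nat 2"
    using assms(5)
    by (simp add: divide_ennreal[symmetric] ennreal_of_nat_eq_real_of_nat of_nat_diff)
  also have "\<dots> = of_nat (\<Sum>u\<in>{2..2}. migration_cost A n ?init [2] u) /
                of_nat (\<Sum>u\<in>{2..2}. migration_potential [2] u)"
    using cost by (simp add: migration_potential_def)
  also have "\<dots> \<le> amortized_migration_factor A n ?init [2]"
    unfolding amortized_migration_factor_def
    by (rule Max_ge, simp, rule image_eqI[OF refl times(2)])
  finally show ?thesis .
qed

theorem theorem16:
  shows "\<exists>c>0::real. \<exists>\<epsilon>\<^sub>0>0::real. \<forall>\<epsilon>. 0 < \<epsilon> \<and> \<epsilon> < \<epsilon>\<^sub>0 \<longrightarrow>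
           (\<forall>A. online_algorithm A \<and> has_competitive_ratio A (1 - \<epsilon>) \<longrightarrow>
              (\<exists>C init arr. amortized_migration_factor A C init arr \<ge> ennreal (c / \<epsilon>)))"
\<comment> \<open>With \<open>n \<ge> 1 / \<epsilon> - 1\<close> the bound
  \<open>(2 * n - 3) / 2\<close> is at least \<open>1 / \<epsilon> - 5/2\<close>, and this is at
  least half of \<open>1 / \<epsilon>\<close> once \<open>1 / \<epsilon> \<ge> 5\<close>.\<close>
proof (rule exI[of _ "1/2"], intro conjI exI[of _ "1/5"] allI impI)
  fix \<epsilon> :: real and A
  assume "0 < \<epsilon> \<and> \<epsilon> < 1/5" and A: "online_algorithm A \<and> has_competitive_ratio A (1 - \<epsilon>)"
  then have eps: "0 < \<epsilon>" and inv: "5 < 1 / \<epsilon>"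
    by (auto simp: field_simps)
  \<comment> \<open>The largest integer strictly below \<open>1 / \<epsilon>\<close>; the floor
    would give equality when \<open>1 / \<epsilon>\<close> is an integer.\<close>
  define n where "n = nat (\<lceil>1 / \<epsilon>\<rceil> - 1)"
  have n: "1 / \<epsilon> - 1 \<le> real n" "real n < 1 / \<epsilon>"
    using inv unfolding n_def by linarith+
  then have "3 < n" and "\<epsilon> * real n < 1"
    using inv eps by (linarith, simp add: field_simps)
  \<comment> \<open>Replacing \<open>1 / \<epsilon>\<close> by a variable makes the estimate purely
    linear.\<close>
  have "r / 2 \<le> (2 * real n - 3) / 2" if "r - 1 \<le> real n" "5 < r" for r
    using that by simp
  from this[OF n(1) inv] have "(1/2) / \<epsilon> \<le> (2 * real n - 3) / 2"
    by (simp add: mult.commute)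
  then have "ennreal ((1/2) / \<epsilon>) \<le> ennreal ((2 * real n - 3) / 2)"
    by (rule ennreal_leI)
  also have "\<dots> \<le> amortized_migration_factor A n [n - 1, n - 2] [2]"
    using A eps \<open>\<epsilon> * real n < 1\<close> \<open>3 < n\<close> by (intro amortized_migration_factor_lower_bound) auto
  finally show "\<exists>C init arr. ennreal ((1/2) / \<epsilon>) \<le> amortized_migration_factor A C init arr"
    by blast
qed simp_all

end
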